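(* Let $\mathbb F$ be a field, $d\ge1$ an integer, $A=A(d,\mathbb F)$. Let $n\ge 1$ and let $(r_1,r_2,\ldots,r_n)$ be an NR word in $A$ that ends with a nonstarred element. Then the element $$(r_1,r_2,\ldots,r_n)+(-1)^n(r_1,r_2,\ldots,r_n)^*$$ is equal to $$\sum_{\substack{0\le j\le d\\ j\ne r_1}}(j,r_1,r_2,\ldots,r_n)+\sum_{\ell=1}^{n-1}(-1)^\ell\sum_{\substack{0\le j\le d\\ j\ne r_\ell,\ j\ne r_{\ell+1}}}(r_1,\ldots,r_\ell,j,r_{\ell+1},\ldots,r_n)+(-1)^n\sum_{\substack{0\le j\le d\\ j\neq r_n}}(r_1,r_2,\ldots,r_n,j),$$ and also equal to $$\sum_{\substack{0\le j\le d\\ j\ne r_n}}(r_1,r_2,\ldots,r_n,j)^*+\sum_{\ell=1}^{n-1}(-1)^{n-\ell}\sum_{\substack{0\le j\le d\\ j\ne r_\ell,\ j\ne r_{\ell+1}}}(r_1,\ldots,r_\ell,j,r_{\ell+1},\ldots,r_n)^*+(-1)^n\sum_{\substack{0\le j\le d\\ j\neq r_1}}(j,r_1,r_2,\ldots,r_n)^*.$$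
   Context: Algebras are associative and have a $1$. For a field $\mathbb F$ and an integer $d\ge 1$, $A=A(d,\mathbb F)$ is the $\mathbb F$-algebra defined by generators $\{e_i\}_{i=0}^d$, $\{e^*_i\}_{i=0}^d$ and relations $e_ie_j=\delta_{i,j}e_i$, $e^*_ie^*_j=\delta_{i,j}e^*_i$ $(0\le i,j\le d)$, $1=\sum_{i=0}^d e_i$, $1=\sum_{i=0}^d e^*_i$. The $e_i,e_i^*$ are the idempotent generators; the $e^*_i$ are called starred and the $e_i$ nonstarred; $i$ is the index of $e_i$ and of $e^*_i$. There is a unique $\mathbb F$-algebra automorphism $*$ of $A$, written $x\mapsto x^*$, that swaps $e_i$ and $e^*_i$ for $0\le i\le d$. For $n\ge1$, a word of length $n$ in $A$ is a product $g_1g_2\cdots g_n$ of idempotent generators such that for $2\le j\le n$ exactly one of $g_{j-1},g_j$ is starred. It begins with $g_1$ and ends with $g_n$. The word is nonrepeating (NR) if $g_{j-1},g_j$ have different indices for $2\le j\le n$. Notation: for $r_1,\dots,r_n\in\{0,\dots,d\}$, $(r_1,\ldots,r_n)$ denotes the word $g_1\cdots g_n$ of length $n$ such that $g_n$ is nonstarred and $g_j$ has index $r_j$ for $1\le j\le n$ (so $g_n=e_{r_n}$, $g_{n-1}=e^*_{r_{n-1}}$, $g_{n-2}=e_{r_{n-2}}$, and so on, alternating). $(r_1,\ldots,r_n)^*$ denotes the image of this word under $*$, i.e. the word with the same indices ending in the starred element $e^*_{r_n}$. *)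

theory Defs
  imports
    "HOL-Library.Poly_Mapping"
    "HOL-Algebra.QuotRing"
    "HOL-Algebra.Module"
begin

text \<open>Lists form the free monoid, written additively, so that
  \<open>'g list \<Rightarrow>\<^sub>0 'k\<close> with its convolution product is the free associative
  \<open>'k\<close>-algebra on \<open>'g\<close>.\<close>

instantiation list :: (type) monoid_add
begin
definition zero_list_def: "0 = []"
definition plus_list_def: "xs + ys = xs @ ys"
instance by standard (simp_all add: zero_list_def plus_list_def)
end

datatype generator = Gen (starred: bool) (index: nat)

type_synonym 'k free = "generator list \<Rightarrow>\<^sub>0 'k"

definition free_gen :: "generator \<Rightarrow> 'k::field free" where
  "free_gen g = Poly_Mapping.single [g] 1"

text \<open>The type \<open>'k free\<close> has generators of every index; the carrier keeps the
  noncommutative polynomials in the generators of index at most \<open>d\<close>.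
  \<open>Poly_Mapping.single 0 c\<close> is the constant \<open>c\<close>.\<close>

definition free_alg :: "nat \<Rightarrow> ('k::field, 'k free) module" where
  "free_alg d = \<lparr>carrier = {p. Poly_Mapping.keys p \<subseteq> lists {g. index g \<le> d}},
     mult = (*), one = 1, zero = 0, add = (+),
     smult = (\<lambda>c p. Poly_Mapping.single 0 c * p)\<rparr>"

definition relators :: "nat \<Rightarrow> 'k::field free set" where
  "relators d =
     {free_gen (Gen s i) * free_gen (Gen s j) - (if i = j then free_gen (Gen s i) else 0) |
        s i j. i \<le> d \<and> j \<le> d}
     \<union> {1 - (\<Sum>i\<le>d. free_gen (Gen s i)) | s. s \<in> {False, True}}"

definition rel_ideal :: "nat \<Rightarrow> 'k::field free set" where
  "rel_ideal d = Idl\<^bsub>free_alg d\<^esub> (relators d)"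

text \<open>The algebra \<open>A(d, 'k)\<close>; scalars act on cosets through representatives, in the
  same style as \<^const>\<open>rcoset_mult\<close>.\<close>

definition idem_alg :: "nat \<Rightarrow> ('k::field, 'k free set) module" where
  "idem_alg d = ring.extend (free_alg d Quot rel_ideal d)
     (module.fields (\<lambda>c X. \<Union>x\<in>X. rel_ideal d +>\<^bsub>free_alg d\<^esub> (c \<odot>\<^bsub>free_alg d\<^esub> x)))"

definition gen :: "nat \<Rightarrow> generator \<Rightarrow> 'k::field free set" where
  "gen d g = rel_ideal d +>\<^bsub>free_alg d\<^esub> free_gen g"

fun swap_gen :: "generator \<Rightarrow> generator" where
  "swap_gen (Gen s i) = Gen (\<not> s) i"

text \<open>The automorphism \<open>*\<close>. On the free algebra it renames letters
  (\<^const>\<open>swap_gen\<close> being an involution, reindexing along \<open>map swap_gen\<close> or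
  its inverse is the same); on \<open>A(d, 'k)\<close> it takes a coset to its image.\<close>

definition free_star :: "'k::field free \<Rightarrow> 'k free" where
  "free_star = Poly_Mapping.map_key (map swap_gen)"

definition star :: "'k::field free set \<Rightarrow> 'k free set" where
  "star X = free_star ` X"

text \<open>Words are given by their sequence of generators, because length, letters and the
  nonrepeating property belong to the sequence; \<open>word_elt\<close> is the element of
  \<open>A(d, 'k)\<close> that it denotes.\<close>

definition is_word :: "nat \<Rightarrow> generator list \<Rightarrow> bool" where
  "is_word d gs \<longleftrightarrow> gs \<noteq> [] \<and> (\<forall>g\<in>set gs. index g \<le> d) \<and> distinct_adj (map starred gs)"

definition nonrepeating :: "generator list \<Rightarrow> bool" where
  "nonrepeating gs \<longleftrightarrow> distinct_adj (map index gs)"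

definition word_elt :: "nat \<Rightarrow> generator list \<Rightarrow> 'k::field free set" where
  "word_elt d gs = foldr (\<lambda>g x. gen d g \<otimes>\<^bsub>idem_alg d\<^esub> x) gs \<one>\<^bsub>idem_alg d\<^esub>"

text \<open>The alternating generators with indices \<open>r\<^sub>1, \<dots>, r\<^sub>n\<close>, the last one nonstarred.\<close>

fun alt_gens :: "nat list \<Rightarrow> generator list" where
  "alt_gens [] = []"
| "alt_gens (r # rs) = Gen (odd (length rs)) r # alt_gens rs"

definition idx_word :: "nat \<Rightarrow> nat list \<Rightarrow> 'k::field free set" where
  "idx_word d rs = word_elt d (alt_gens rs)"


subsection \<open>The construction has the expected properties\<close>

lemma free_alg_simps [simp]:
  "carrier (free_alg d) = {p. Poly_Mapping.keys p \<subseteq> lists {g. index g \<le> d}}"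
  "mult (free_alg d) = (*)" "one (free_alg d) = 1" "zero (free_alg d) = 0"
  "add (free_alg d) = (+)" "smult (free_alg d) = (\<lambda>c p. Poly_Mapping.single 0 c * p)"
  by (simp_all add: free_alg_def)

lemma free_mult_closed:
  fixes p q :: "'k::field free"
  assumes "Poly_Mapping.keys p \<subseteq> lists S" "Poly_Mapping.keys q \<subseteq> lists S"
  shows "Poly_Mapping.keys (p * q) \<subseteq> lists S"
  using keys_mult[of p q] assms by (fastforce simp: plus_list_def)

lemma free_add_closed:
  fixes p q :: "'k::field free"
  assumes "Poly_Mapping.keys p \<subseteq> S" "Poly_Mapping.keys q \<subseteq> S"
  shows "Poly_Mapping.keys (p + q) \<subseteq> S" "Poly_Mapping.keys (p - q) \<subseteq> S"
  using Poly_Mapping.keys_add[of p q] keys_diff[of p q] assms by blast+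

lemma ring_free_alg: "ring (free_alg d :: ('k::field, 'k free) module)"
proof (rule ringI)
  show "abelian_group (free_alg d :: ('k, 'k free) module)"
  proof (rule abelian_groupI)
    fix x :: "'k free" assume "x \<in> carrier (free_alg d)"
    then have "- x \<in> carrier (free_alg d)" by simp
    then show "\<exists>y\<in>carrier (free_alg d). y \<oplus>\<^bsub>free_alg d\<^esub> x = \<zero>\<^bsub>free_alg d\<^esub>"
      by (intro bexI[of _ "- x"]) simp_all
  qed (simp_all add: free_add_closed add.assoc add.commute)
  show "Group.monoid (free_alg d :: ('k, 'k free) module)"
    by (rule monoidI) (simp_all add: free_mult_closed mult.assoc zero_list_def)
qed (simp_all add: distrib_left distrib_right)

lemma free_gen_closed [simp]: "index g \<le> d \<Longrightarrow> free_gen g \<in> carrier (free_alg d)"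
  by (simp add: free_gen_def)

lemma free_gen_sum_closed:
  "(\<Sum>i\<le>d. free_gen (Gen s i)) \<in> carrier (free_alg d :: ('k::field, 'k free) module)"
proof -
  interpret ring "free_alg d :: ('k, 'k free) module" by (rule ring_free_alg)
  have "(\<Sum>i\<in>B. free_gen (Gen s i)) \<in> carrier (free_alg d :: ('k, 'k free) module)"
    if "finite B" "B \<subseteq> {..d}" for B
    using that
  proof (induction B rule: finite_induct)
    case empty
    show ?case using zero_closed by (simp only: sum.empty free_alg_simps(4))
  next
    case (insert i B)
    have "free_gen (Gen s i) \<in> carrier (free_alg d :: ('k, 'k free) module)"
      by (rule free_gen_closed) (use insert in simp)
    moreover have "(\<Sum>i\<in>B. free_gen (Gen s i)) \<in> carrier (free_alg d :: ('k, 'k free) module)"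
      using insert by blast
    ultimately show ?case
      unfolding sum.insert[OF insert(1,2)] by (rule a_closed[unfolded free_alg_simps(5)])
  qed
  then show ?thesis by blast
qed

lemma free_minus: "x \<in> carrier (free_alg d) \<Longrightarrow> y \<in> carrier (free_alg d) \<Longrightarrow>
    x \<ominus>\<^bsub>free_alg d\<^esub> y = (x - y :: 'k::field free)"
proof -
  interpret ring "free_alg d :: ('k, 'k free) module" by (rule ring_free_alg)
  assume xy: "x \<in> carrier (free_alg d)" "y \<in> carrier (free_alg d)"
  have "\<ominus>\<^bsub>free_alg d\<^esub> y = - y"
    by (rule minus_equality) (use xy in simp_all)
  then show ?thesis by (simp add: a_minus_def)
qed

lemma relators_carrier: "relators d \<subseteq> carrier (free_alg d :: ('k::field, 'k free) module)"
proof -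
  let ?C = "carrier (free_alg d :: ('k, 'k free) module)"
  interpret ring "free_alg d :: ('k, 'k free) module" by (rule ring_free_alg)
  have diff: "x - y \<in> ?C" if "x \<in> ?C" "y \<in> ?C" for x y
    using minus_closed[OF that] free_minus[OF that] by (simp only:)
  have prod: "x * y \<in> ?C" if "x \<in> ?C" "y \<in> ?C" for x y
    using m_closed[OF that] by (simp only: free_alg_simps(2))
  have one: "1 \<in> ?C" using one_closed by (simp only: free_alg_simps(3))
  have zero: "0 \<in> ?C" using zero_closed by (simp only: free_alg_simps(4))
  have if_in: "(if i = j then free_gen (Gen s i) else 0) \<in> ?C" if "i \<le> d" for i j s
    using zero free_gen_closed[of "Gen s i" d] that by (simp del: free_alg_simps)
  show ?thesis
  proof
    fix x :: "'k free" assume "x \<in> relators d"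
    then consider s i j where "i \<le> d" "j \<le> d"
        "x = free_gen (Gen s i) * free_gen (Gen s j) - (if i = j then free_gen (Gen s i) else 0)"
      | s where "x = 1 - (\<Sum>i\<le>d. free_gen (Gen s i))"
      unfolding relators_def by blast
    then show "x \<in> ?C"
    proof cases
      case 1
      show ?thesis unfolding 1(3)
        by (intro diff prod if_in free_gen_closed) (simp_all add: 1)
    next
      case 2
      show ?thesis unfolding 2 by (intro diff one free_gen_sum_closed)
    qed
  qed
qed

lemma ideal_rel_ideal: "ideal (rel_ideal d) (free_alg d :: ('k::field, 'k free) module)"
  unfolding rel_ideal_def by (rule ring.genideal_ideal[OF ring_free_alg relators_carrier])

lemma idem_alg_simps:
  "carrier (idem_alg d) = carrier (free_alg d Quot rel_ideal d)"
  "mult (idem_alg d) = mult (free_alg d Quot rel_ideal d)"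
  "one (idem_alg d) = one (free_alg d Quot rel_ideal d)"
  "zero (idem_alg d) = zero (free_alg d Quot rel_ideal d)"
  "add (idem_alg d) = add (free_alg d Quot rel_ideal d)"
  "smult (idem_alg d) =
     (\<lambda>c X. \<Union>x\<in>X. rel_ideal d +>\<^bsub>free_alg d\<^esub> (c \<odot>\<^bsub>free_alg d\<^esub> x))"
  by (simp_all add: idem_alg_def ring.defs module.defs monoid.defs)


lemma ring_idem_alg: "ring (idem_alg d :: ('k::field, 'k free set) module)"
proof -
  interpret Q: ring "free_alg d Quot rel_ideal d :: 'k free set ring"
    by (rule ideal.quotient_is_ring[OF ideal_rel_ideal])
  show ?thesis
  proof (rule ringI)
    show "abelian_group (idem_alg d :: ('k, 'k free set) module)"
      by (rule abelian_groupI)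
        (simp_all add: idem_alg_simps Q.a_ac Q.add.l_inv_ex del: free_alg_simps)
    show "Group.monoid (idem_alg d :: ('k, 'k free set) module)"
      by (rule monoidI) (auto simp: idem_alg_simps Q.m_assoc simp del: free_alg_simps)
  qed (auto simp: idem_alg_simps Q.l_distr Q.r_distr simp del: free_alg_simps)
qed

abbreviation quot_map :: "nat \<Rightarrow> 'k::field free \<Rightarrow> 'k free set" where
  "quot_map d p \<equiv> rel_ideal d +>\<^bsub>free_alg d\<^esub> p"

lemma quot_map_hom:
  "quot_map d \<in> ring_hom (free_alg d) (idem_alg d :: ('k::field, 'k free set) module)"
  using ideal.rcos_ring_hom[OF ideal_rel_ideal, of d]
  by (simp add: ring_hom_def idem_alg_simps del: free_alg_simps)

lemma quot_map_eq_iff: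
  assumes "x \<in> carrier (free_alg d)" "y \<in> carrier (free_alg d)"
  shows "quot_map d x = quot_map d y \<longleftrightarrow> (x - y :: 'k::field free) \<in> rel_ideal d"
proof -
  interpret ideal "rel_ideal d" "free_alg d :: ('k, 'k free) module"
    by (rule ideal_rel_ideal)
  show ?thesis
    using quotient_eq_iff_same_a_r_cos[OF ideal_rel_ideal assms] free_minus[OF assms]
    by simp
qed

lemma smult_quot_map:
  fixes c :: "'k::field"
  assumes x: "x \<in> carrier (free_alg d)"
  shows "c \<odot>\<^bsub>idem_alg d\<^esub> quot_map d x = quot_map d (c \<odot>\<^bsub>free_alg d\<^esub> x)"
proof -
  interpret ideal "rel_ideal d" "free_alg d :: ('k, 'k free) module"
    by (rule ideal_rel_ideal)
  have c: "Poly_Mapping.single 0 c \<in> carrier (free_alg d)" by (simp add: zero_list_def)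
  have *: "quot_map d (c \<odot>\<^bsub>free_alg d\<^esub> y) = quot_map d (c \<odot>\<^bsub>free_alg d\<^esub> x)"
    if y: "y \<in> quot_map d x" for y
  proof -
    have yc: "y \<in> carrier (free_alg d)" by (rule a_elemrcos_carrier[OF x y])
    have "quot_map d x = quot_map d y" by (rule a_repr_independence'[OF y x])
    then have "y - x \<in> rel_ideal d" using quot_map_eq_iff[OF yc x] by simp
    then have "Poly_Mapping.single 0 c * (y - x) \<in> rel_ideal d"
      using I_l_closed[OF _ c] by (simp only: free_alg_simps(2))
    then have "(c \<odot>\<^bsub>free_alg d\<^esub> y) - (c \<odot>\<^bsub>free_alg d\<^esub> x) \<in> rel_ideal d"
      by (simp only: free_alg_simps(6) right_diff_distrib)
    moreover have "c \<odot>\<^bsub>free_alg d\<^esub> z \<in> carrier (free_alg d)"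
      if "z \<in> carrier (free_alg d)" for z
      using m_closed[OF c that] by (simp only: free_alg_simps(2,6))
    ultimately show ?thesis
      using quot_map_eq_iff yc x by blast
  qed
  have "c \<odot>\<^bsub>idem_alg d\<^esub> quot_map d x = (\<Union>y\<in>quot_map d x. quot_map d (c \<odot>\<^bsub>free_alg d\<^esub> y))"
    by (simp only: idem_alg_simps(6))
  also have "\<dots> = (\<Union>y\<in>quot_map d x. quot_map d (c \<odot>\<^bsub>free_alg d\<^esub> x))"
    by (rule SUP_cong[OF refl *])
  also have "\<dots> = quot_map d (c \<odot>\<^bsub>free_alg d\<^esub> x)"
    using a_rcos_self[OF x] by (intro SUP_const) blast
  finally show ?thesis .
qed

lemma relators_rel_ideal: "relators d \<subseteq> rel_ideal d"
  unfolding rel_ideal_def by (rule ring.genideal_self[OF ring_free_alg relators_carrier])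

lemma gen_relations:
  fixes A :: "('k::field, 'k free set) module"
  assumes A: "A = idem_alg d"
  shows "i \<le> d \<Longrightarrow> j \<le> d \<Longrightarrow>
      gen d (Gen s i) \<otimes>\<^bsub>A\<^esub> gen d (Gen s j) = (if i = j then gen d (Gen s i) else \<zero>\<^bsub>A\<^esub>)"
    and "(\<Oplus>\<^bsub>A\<^esub> i \<in> {0..d}. gen d (Gen s i)) = \<one>\<^bsub>A\<^esub>"
proof -
  interpret F: ring "free_alg d :: ('k, 'k free) module" by (rule ring_free_alg)
  interpret R: ring A unfolding A by (rule ring_idem_alg)
  interpret ring_hom_ring "free_alg d" A "quot_map d"
    unfolding A by (rule ring_hom_ringI2[OF ring_free_alg ring_idem_alg quot_map_hom])
  have eqI: "quot_map d x = quot_map d y"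
    if "x - y \<in> relators d" "x \<in> carrier (free_alg d)" "y \<in> carrier (free_alg d)"
    for x y :: "'k free"
    using quot_map_eq_iff[OF that(2,3)] relators_rel_ideal[of d] that(1) by blast
  note free_alg_simps(1) [simp del]
  {
    assume ij: "i \<le> d" "j \<le> d"
    let ?x = "free_gen (Gen s i) :: 'k free" and ?y = "free_gen (Gen s j) :: 'k free"
    have xy: "?x \<in> carrier (free_alg d)" "?y \<in> carrier (free_alg d)" using ij by simp_all
    have "quot_map d (?x \<otimes>\<^bsub>free_alg d\<^esub> ?y) = quot_map d (if i = j then ?x else \<zero>\<^bsub>free_alg d\<^esub>)"
    proof (rule eqI)
      show "?x \<otimes>\<^bsub>free_alg d\<^esub> ?y - (if i = j then ?x else \<zero>\<^bsub>free_alg d\<^esub>) \<in> relators d"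
        unfolding relators_def free_alg_simps using ij by blast
      show "?x \<otimes>\<^bsub>free_alg d\<^esub> ?y \<in> carrier (free_alg d)" by (rule F.m_closed[OF xy])
      show "(if i = j then ?x else \<zero>\<^bsub>free_alg d\<^esub>) \<in> carrier (free_alg d)"
        using xy(1) F.zero_closed by (cases "i = j") (simp_all del: free_alg_simps)
    qed
    then show "gen d (Gen s i) \<otimes>\<^bsub>A\<^esub> gen d (Gen s j) =
        (if i = j then gen d (Gen s i) else \<zero>\<^bsub>A\<^esub>)"
      using hom_mult[OF xy] hom_zero by (simp add: gen_def del: free_alg_simps split: if_splits)
  }
  have fin: "(\<Oplus>\<^bsub>A\<^esub> i \<in> B. quot_map d (f i)) = quot_map d (sum f B)
      \<and> sum f B \<in> carrier (free_alg d)"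
    if "finite B" "f \<in> B \<rightarrow> carrier (free_alg d)" for B :: "nat set" and f
    using that
  proof (induction B rule: finite_induct)
    case empty
    then show ?case using hom_zero F.zero_closed by simp
  next
    case (insert b B)
    have cl: "f b \<in> carrier (free_alg d)" "sum f B \<in> carrier (free_alg d)"
      using insert by auto
    have "(\<Oplus>\<^bsub>A\<^esub> i \<in> insert b B. quot_map d (f i))
        = quot_map d (f b) \<oplus>\<^bsub>A\<^esub> (\<Oplus>\<^bsub>A\<^esub> i \<in> B. quot_map d (f i))"
      using insert by (intro R.finsum_insert) (auto intro!: hom_closed)
    then show ?case
      using insert hom_add[OF cl] F.a_closed[OF cl] by simp
  qed
  have "(\<Oplus>\<^bsub>A\<^esub> i \<in> {..d}. quot_map d (free_gen (Gen s i)))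
      = quot_map d (\<Sum>i\<le>d. free_gen (Gen s i))"
    using fin[of "{..d}" "\<lambda>i. free_gen (Gen s i)"] by simp
  also have "\<dots> = quot_map d 1"
  proof (rule eqI[symmetric])
    show "(1 :: 'k free) - (\<Sum>i\<le>d. free_gen (Gen s i)) \<in> relators d"
      unfolding relators_def by blast
    show "1 \<in> carrier (free_alg d :: ('k, 'k free) module)"
      using F.one_closed by simp
  qed (rule free_gen_sum_closed)
  also have "\<dots> = \<one>\<^bsub>A\<^esub>" using hom_one by simp
  finally show "(\<Oplus>\<^bsub>A\<^esub> i \<in> {0..d}. gen d (Gen s i)) = \<one>\<^bsub>A\<^esub>"
    by (simp add: gen_def atLeast0AtMost)
qed

lemma swap_gen_swap_gen [simp]: "swap_gen (swap_gen g) = g"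
  by (cases g) simp

lemma swap_gen_simps [simp]: "index (swap_gen g) = index g" "starred (swap_gen g) \<longleftrightarrow> \<not> starred g"
  by (cases g; simp)+

lemma map_swap_gen_idem [simp]: "map swap_gen (map swap_gen w) = w"
  by (simp add: map_idI)

lemma inj_map_swap_gen: "inj (map swap_gen)"
  by (metis injI map_swap_gen_idem)

lemma free_star_add: "free_star (p + q) = free_star p + free_star q"
  unfolding free_star_def by (rule Poly_Mapping.map_key_plus[OF inj_map_swap_gen])

lemma free_star_single:
  "free_star (Poly_Mapping.single w c) = Poly_Mapping.single (map swap_gen w) c"
  unfolding free_star_def
  using Poly_Mapping.map_key_single[OF inj_map_swap_gen, of "map swap_gen w" c]
  by (simp only: map_swap_gen_idem)

lemma free_star_zero: "free_star 0 = 0"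
  unfolding free_star_def by (rule Poly_Mapping.map_key_zero[OF inj_map_swap_gen])

lemma free_star_diff: "free_star (p - q) = free_star p - free_star q"
  using free_star_add[of "p - q" q] by (simp add: algebra_simps)

lemma free_star_sum: "free_star (sum f B) = (\<Sum>b\<in>B. free_star (f b))"
  by (induction B rule: infinite_finite_induct) (simp_all add: free_star_zero free_star_add)

lemma free_star_star: "free_star (free_star p) = p"
  unfolding free_star_def Poly_Mapping.map_key_compose[OF inj_map_swap_gen inj_map_swap_gen]
  by (simp add: comp_def Poly_Mapping.map_key_id del: map_map)

lemma free_induct [case_names zero add]:
  fixes p :: "'k::field free"
  assumes "P 0" "\<And>p w c. P p \<Longrightarrow> P (p + Poly_Mapping.single w c)"
  shows "P p"
proof (induction p rule: Poly_Mapping.update_induct)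
  case const
  then show ?case by (rule assms)
next
  case (update f a b)
  have "Poly_Mapping.update a b f = f + Poly_Mapping.single a b"
    using update(1)
    by (intro poly_mapping_eqI)
      (auto simp: lookup_update lookup_add lookup_single in_keys_iff when_def)
  then show ?case using assms(2) update by simp
qed

lemma free_star_mult: "free_star (p * q) = free_star p * free_star q"
proof (induction p rule: free_induct)
  case (add p w c)
  have "free_star (Poly_Mapping.single w c * q) = free_star (Poly_Mapping.single w c) * free_star q"
    by (induction q rule: free_induct)
      (simp_all add: free_star_zero free_star_add free_star_single distrib_left mult_single
        plus_list_def)
  with add show ?case by (simp add: free_star_add distrib_right)
qed (simp add: free_star_zero)

lemma free_star_one: "free_star 1 = 1"
proof -
  have "map swap_gen 0 = 0" by (simp add: zero_list_def)
  then show ?thesis using free_star_single[of 0 1] by (simp only: single_one)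
qed

lemma free_star_gen: "free_star (free_gen g) = free_gen (swap_gen g)"
  by (simp add: free_gen_def free_star_single)

lemma free_star_closed:
  "p \<in> carrier (free_alg d) \<Longrightarrow> free_star p \<in> carrier (free_alg d)"
  by (fastforce simp: free_star_def Poly_Mapping.keys_map_key[OF inj_map_swap_gen])

lemma free_star_hom:
  "ring_hom_ring (free_alg d) (free_alg d) (free_star :: 'k::field free \<Rightarrow> 'k free)"
proof (intro ring_hom_ringI2 ring_free_alg ring_hom_memI)
  fix x :: "'k free" assume "x \<in> carrier (free_alg d)"
  then show "free_star x \<in> carrier (free_alg d)" by (rule free_star_closed)
qed (simp_all add: free_star_mult free_star_add free_star_one)

lemma free_star_relators: "free_star ` relators d \<subseteq> (relators d :: 'k::field free set)"
proof clarify
  fix x :: "'k free" assume "x \<in> relators d"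
  then consider s i j where "i \<le> d" "j \<le> d"
      "x = free_gen (Gen s i) * free_gen (Gen s j) - (if i = j then free_gen (Gen s i) else 0)"
    | s where "x = 1 - (\<Sum>i\<le>d. free_gen (Gen s i))"
    unfolding relators_def by blast
  then show "free_star x \<in> relators d"
  proof cases
    case 1
    then have "free_star x = free_gen (Gen (\<not> s) i) * free_gen (Gen (\<not> s) j)
        - (if i = j then free_gen (Gen (\<not> s) i) else 0)"
      by (simp add: free_star_diff free_star_mult free_star_gen free_star_zero)
    with 1 show ?thesis unfolding relators_def by blast
  next
    case 2
    then have "free_star x = 1 - (\<Sum>i\<le>d. free_gen (Gen (\<not> s) i))"
      by (simp add: free_star_diff free_star_sum free_star_gen free_star_one)
    then show ?thesis unfolding relators_def by blast
  qed
qed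

lemma free_star_rel_ideal:
  fixes x :: "'k::field free"
  assumes x: "x \<in> rel_ideal d"
  shows "free_star x \<in> rel_ideal d"
proof -
  let ?J = "{p \<in> carrier (free_alg d). free_star p \<in> rel_ideal d} :: 'k free set"
  have J: "ideal ?J (free_alg d)"
    by (rule ring_hom_ring.ideal_vimage[OF free_star_hom ideal_rel_ideal])
  have "relators d \<subseteq> ?J"
    using relators_carrier[of d] free_star_relators[of d] relators_rel_ideal[of d]
    by (blast dest: subsetD)
  from ring.genideal_minimal[OF ring_free_alg J this] have "rel_ideal d \<subseteq> ?J"
    by (simp only: rel_ideal_def)
  with x show ?thesis by blast
qed

lemma star_quot_map:
  fixes p :: "'k::field free"
  assumes "p \<in> carrier (free_alg d)"
  shows "star (quot_map d p) = quot_map d (free_star p)"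
proof -
  have im: "free_star ` rel_ideal d = (rel_ideal d :: 'k free set)"
  proof
    show "free_star ` rel_ideal d \<subseteq> (rel_ideal d :: 'k free set)"
      using free_star_rel_ideal by blast
    show "rel_ideal d \<subseteq> free_star ` (rel_ideal d :: 'k free set)"
    proof
      fix x :: "'k free" assume "x \<in> rel_ideal d"
      then have "free_star x \<in> rel_ideal d" by (rule free_star_rel_ideal)
      moreover have "x = free_star (free_star x)" by (simp only: free_star_star)
      ultimately show "x \<in> free_star ` rel_ideal d" by (rule rev_image_eqI)
    qed
  qed
  have coset: "quot_map d q = (\<lambda>h. h + q) ` rel_ideal d" for q :: "'k free"
    by (auto simp: a_r_coset_def' simp del: free_alg_simps(1))
  have "star (quot_map d p) = (\<lambda>h. h + free_star p) ` (free_star ` rel_ideal d)"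
    unfolding star_def coset by (simp only: image_image free_star_add)
  then show ?thesis unfolding im coset .
qed

lemma star_gen: "index g \<le> d \<Longrightarrow> star (gen d g) = gen d (swap_gen g)"
  by (simp add: gen_def star_quot_map[OF free_gen_closed] free_star_gen)

lemma idem_alg_carrier: "carrier (idem_alg d) = quot_map d ` carrier (free_alg d)"
  by (auto simp: idem_alg_simps FactRing_def A_RCOSETS_def' simp del: free_alg_simps)

lemma star_automorphism:
  "star \<in> ring_iso (idem_alg d) (idem_alg d :: ('k::field, 'k free set) module)"
proof -
  interpret F: ring "free_alg d :: ('k, 'k free) module" by (rule ring_free_alg)
  interpret ring_hom_ring "free_alg d :: ('k, 'k free) module" "idem_alg d" "quot_map d"
    by (rule ring_hom_ringI2[OF ring_free_alg ring_idem_alg quot_map_hom])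
  interpret S: ring_hom_ring "free_alg d :: ('k, 'k free) module" "free_alg d" free_star
    by (rule free_star_hom)
  have inv: "star (star X) = X" if "X \<in> carrier (idem_alg d)" for X :: "'k free set"
    by (simp add: star_def image_image free_star_star)
  have closed: "star X \<in> carrier (idem_alg d)" if "X \<in> carrier (idem_alg d)"
    for X :: "'k free set"
  proof -
    from that obtain x where x: "x \<in> carrier (free_alg d)" "X = quot_map d x"
      unfolding idem_alg_carrier by blast
    show ?thesis
      unfolding idem_alg_carrier x(2) star_quot_map[OF x(1)]
      by (rule imageI[OF free_star_closed[OF x(1)]])
  qed
  show ?thesis
  proof (rule ring_iso_memI)
    show "bij_betw star (carrier (idem_alg d)) (carrier (idem_alg d :: ('k, 'k free set) module))"
      by (rule bij_betw_byWitness[where f' = star]) (use inv closed in auto)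
    show "star \<one>\<^bsub>idem_alg d\<^esub> = \<one>\<^bsub>idem_alg d :: ('k, 'k free set) module\<^esub>"
      using star_quot_map[OF F.one_closed] hom_one S.hom_one by (simp del: free_alg_simps)
    fix X Y :: "'k free set"
    assume "X \<in> carrier (idem_alg d)" "Y \<in> carrier (idem_alg d)"
    then obtain x y where xy: "x \<in> carrier (free_alg d)" "y \<in> carrier (free_alg d)"
      "X = quot_map d x" "Y = quot_map d y"
      unfolding idem_alg_carrier by blast
    note cl = xy(1,2) S.hom_closed[OF xy(1)] S.hom_closed[OF xy(2)]
    show "star (X \<otimes>\<^bsub>idem_alg d\<^esub> Y) = star X \<otimes>\<^bsub>idem_alg d\<^esub> star Y"
      unfolding xy(3,4) hom_mult[OF xy(1,2), symmetric] star_quot_map[OF xy(1)]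
        star_quot_map[OF xy(2)] star_quot_map[OF F.m_closed[OF xy(1,2)]]
        S.hom_mult[OF xy(1,2)] hom_mult[OF cl(3,4)] ..
    show "star (X \<oplus>\<^bsub>idem_alg d\<^esub> Y) = star X \<oplus>\<^bsub>idem_alg d\<^esub> star Y"
      unfolding xy(3,4) hom_add[OF xy(1,2), symmetric] star_quot_map[OF xy(1)]
        star_quot_map[OF xy(2)] star_quot_map[OF F.a_closed[OF xy(1,2)]]
        S.hom_add[OF xy(1,2)] hom_add[OF cl(3,4)] ..
  qed (use closed in blast)
qed

lemma star_smult:
  fixes c :: "'k::field"
  assumes "X \<in> carrier (idem_alg d)"
  shows "star (c \<odot>\<^bsub>idem_alg d\<^esub> X) = c \<odot>\<^bsub>idem_alg d\<^esub> star X"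
proof -
  interpret F: ring "free_alg d :: ('k, 'k free) module" by (rule ring_free_alg)
  obtain x where x: "x \<in> carrier (free_alg d)" "X = quot_map d x"
    using assms unfolding idem_alg_carrier by blast
  have c: "Poly_Mapping.single 0 c \<in> carrier (free_alg d)" by (simp add: zero_list_def)
  have "c \<odot>\<^bsub>free_alg d\<^esub> x \<in> carrier (free_alg d)"
    using F.m_closed[OF c x(1)] by simp
  moreover have "free_star (c \<odot>\<^bsub>free_alg d\<^esub> x) = c \<odot>\<^bsub>free_alg d\<^esub> free_star x"
    by (simp add: free_star_mult free_star_single zero_list_def)
  ultimately show ?thesis
    using x by (simp add: smult_quot_map star_quot_map free_star_closed del: free_alg_simps)
qed

end

theory Submission
  imports Defs
begin

text \<open>Write \<open>D\<^sub>l\<close> for the word \<open>r\<close> with its \<open>l\<close>-th index doubled. If \<open>j\<close> ran over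
  all of \<open>{0..d}\<close>, then the inserted letters would sum to \<open>1\<close>: inside the word this leaves two adjacent
  idempotents of the same kind with distinct indices, hence \<open>0\<close>, and at the two ends it leaves the word and
  its image under \<open>*\<close>. So the \<open>l\<close>-th inner sum is \<open>- D\<^sub>l - D\<^sub>l\<^sub>+\<^sub>1\<close>, and the alternating sum
  telescopes. The second identity is \<open>(-1)\<^sup>n\<close> times the image of the first one under \<open>*\<close>.\<close>

section \<open>Finite sums in a ring\<close>

lemma (in ring) finsum_Diff_singleton:
  assumes "finite B" "a \<in> B" "f \<in> B \<rightarrow> carrier R"
  shows "finsum R f (B - {a}) = finsum R f B \<ominus> f a"
proof -
  have f: "f \<in> (B - {a}) \<rightarrow> carrier R" "f a \<in> carrier R" using assms by auto
  have "finsum R f (insert a (B - {a})) = f a \<oplus> finsum R f (B - {a})"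
    using assms f by (intro finsum_insert) auto
  then have "finsum R f B = finsum R f (B - {a}) \<oplus> f a"
    using assms f by (simp add: insert_absorb a_comm)
  then show ?thesis using f by (simp add: a_minus_def a_assoc r_neg)
qed

text \<open>Each inner \<open>D\<close> occurs in two consecutive summands, which carry opposite
  signs. For \<open>m = 0\<close> the right side is \<open>D 1\<close> minus itself, so words of
  length one need no separate argument.\<close>

lemma (in ring) alternating_finsum_telescope:
  assumes "\<And>l. D l \<in> carrier R"
  shows "(\<Oplus>l\<in>{1..m}. (\<ominus> \<one>) [^] l \<otimes> (\<ominus> D l \<ominus> D (Suc l)))
    = D 1 \<oplus> (\<ominus> \<one>) [^] Suc m \<otimes> D (Suc m)"
proof (induction m)
  case 0
  show ?case using assms by (simp add: r_neg l_minus)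
next
  case (Suc m)
  let ?u = "(\<ominus> \<one>) [^] Suc m" and ?f = "\<lambda>l. (\<ominus> \<one>) [^] l \<otimes> (\<ominus> D l \<ominus> D (Suc l))"
  have u: "?u \<in> carrier R" by simp
  have "finsum R ?f {1..Suc m} = finsum R ?f (insert (Suc m) {1..m})"
    by (rule arg_cong[where f = "finsum R ?f"]) auto
  also have "\<dots> = ?f (Suc m) \<oplus> finsum R ?f {1..m}"
    using assms by (intro finsum_insert) auto
  also have "\<dots> = ?u \<otimes> (\<ominus> D (Suc m) \<ominus> D (Suc (Suc m))) \<oplus> (D 1 \<oplus> ?u \<otimes> D (Suc m))"
    by (simp only: Suc.IH)
  \<comment> \<open>The sign is treated as an arbitrary ring element \<open>?u\<close>:
    distributivity alone cancels \<open>?u \<otimes> D (Suc m)\<close>.\<close>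
  also have "\<dots> = D 1 \<oplus> (?u \<otimes> \<ominus> \<one>) \<otimes> D (Suc (Suc m))"
    using assms u by algebra
  also have "?u \<otimes> \<ominus> \<one> = (\<ominus> \<one>) [^] Suc (Suc m)" by simp
  finally show ?case .
qed

section \<open>Scalars and words in the algebra\<close>

text \<open>The copy of the field inside the algebra. It replaces the scalar action, a union over
  representatives, by ring multiplication, so that the remaining computation takes place in a
  ring.\<close>

definition scal :: "nat \<Rightarrow> 'k::field \<Rightarrow> 'k free set" where
  "scal d c = quot_map d (Poly_Mapping.single 0 c)"

lemma scal_carrier: "Poly_Mapping.single 0 c \<in> carrier (free_alg d :: ('k::field, 'k free) module)"
  by (simp add: zero_list_def)

context
  fixes A :: "('k::field, 'k free set) module" and d :: nat
  assumes A: "A = idem_alg d"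
begin

interpretation F: ring "free_alg d :: ('k, 'k free) module" by (rule ring_free_alg)
interpretation R: ring A unfolding A by (rule ring_idem_alg)
interpretation Q: ring_hom_ring "free_alg d" A "quot_map d"
  unfolding A by (rule ring_hom_ringI2[OF ring_free_alg ring_idem_alg quot_map_hom])
interpretation S: ring_hom_ring A A star
  using star_automorphism[of d] unfolding A ring_iso_def
  by (intro ring_hom_ringI2 ring_idem_alg) blast

lemma scal_closed: "scal d c \<in> carrier A"
  unfolding scal_def by (rule Q.hom_closed[OF scal_carrier])

text \<open>On the free algebra a scalar acts as multiplication by a constant polynomial, and the
  quotient map is multiplicative.\<close>

lemma smult_eq_scal_mult:
  assumes "X \<in> carrier A"
  shows "c \<odot>\<^bsub>A\<^esub> X = scal d c \<otimes>\<^bsub>A\<^esub> X"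
proof -
  obtain x where x: "x \<in> carrier (free_alg d)" "X = quot_map d x"
    using assms unfolding A idem_alg_carrier by blast
  show ?thesis
    using Q.hom_mult[OF scal_carrier x(1)] smult_quot_map[OF x(1)]
    by (simp add: scal_def x(2) A del: free_alg_simps(1))
qed

lemma scal_mult: "scal d (b * c) = scal d b \<otimes>\<^bsub>A\<^esub> scal d c"
  using Q.hom_mult[OF scal_carrier scal_carrier, of b c]
  by (simp add: scal_def mult_single del: free_alg_simps(1))

text \<open>The constants \<open>-1\<close> and \<open>1\<close> add up to zero, so the image of
  \<open>-1\<close> is the negative of the unit of \<open>A\<close>. This gives the signs the form
  required by the telescoping lemma.\<close>

lemma scal_power_minus_one: "scal d ((-1) ^ k) = (\<ominus>\<^bsub>A\<^esub> \<one>\<^bsub>A\<^esub>) [^]\<^bsub>A\<^esub> k"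
proof -
  have one: "scal d 1 = \<one>\<^bsub>A\<^esub>"
    using Q.hom_one by (simp add: scal_def single_one del: free_alg_simps(1))
  have "Poly_Mapping.single 0 (-1) + 1 = (0 :: 'k free)"
    unfolding single_one[symmetric] single_add[symmetric] by simp
  then have "scal d (-1) \<oplus>\<^bsub>A\<^esub> \<one>\<^bsub>A\<^esub> = \<zero>\<^bsub>A\<^esub>"
    using Q.hom_add[OF scal_carrier F.one_closed, of "-1"] Q.hom_zero Q.hom_one
    by (simp add: scal_def del: free_alg_simps(1))
  then have neg: "scal d (-1) = \<ominus>\<^bsub>A\<^esub> \<one>\<^bsub>A\<^esub>"
    using R.minus_equality[OF _ R.one_closed scal_closed] by simp
  show ?thesis
  proof (induction k)
    case (Suc k)
    have "scal d ((-1) ^ Suc k) = scal d ((-1) ^ k) \<otimes>\<^bsub>A\<^esub> scal d (-1)"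
      by (simp only: power_Suc2 scal_mult)
    then show ?case by (simp add: Suc neg)
  qed (simp add: one)
qed

lemma gen_closed: "index g \<le> d \<Longrightarrow> gen d g \<in> carrier A"
  unfolding gen_def by (rule Q.hom_closed[OF free_gen_closed])

lemma word_elt_closed: "\<forall>g\<in>set gs. index g \<le> d \<Longrightarrow> word_elt d gs \<in> carrier A"
  unfolding word_elt_def by (induction gs) (simp_all add: gen_closed flip: A)

lemma word_elt_Cons: "word_elt d (g # gs) = gen d g \<otimes>\<^bsub>A\<^esub> word_elt d gs"
  by (simp add: word_elt_def A)

lemma word_elt_append:
  assumes "\<forall>g\<in>set (gs @ hs). index g \<le> d"
  shows "word_elt d (gs @ hs) = word_elt d gs \<otimes>\<^bsub>A\<^esub> word_elt d hs"
  using assms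
proof (induction gs)
  case Nil
  then show ?case using word_elt_closed[of hs] by (simp add: word_elt_def flip: A)
next
  case (Cons g gs)
  then show ?case
    using word_elt_closed by (simp add: word_elt_Cons gen_closed R.m_assoc)
qed

lemma star_word_elt:
  assumes "\<forall>g\<in>set gs. index g \<le> d"
  shows "star (word_elt d gs :: 'k free set) = word_elt d (map swap_gen gs)"
  using assms
proof (induction gs)
  case Nil
  then show ?case using S.hom_one by (simp add: word_elt_def flip: A)
next
  case (Cons g gs)
  then show ?case
    using word_elt_closed by (simp add: word_elt_Cons gen_closed star_gen)
qed

text \<open>Distributivity on both sides isolates the sum of all idempotents of kind
  \<open>s\<close>, which is one. The lists may be arbitrary: removing a letter from an alternating
  word destroys the alternation.\<close>

lemma finsum_word_elt_insert:
  assumes "\<forall>g\<in>set (gs @ hs). index g \<le> d"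
  shows "(\<Oplus>\<^bsub>A\<^esub>j\<in>{0..d}. word_elt d (gs @ Gen s j # hs)) = word_elt d (gs @ hs)"
proof -
  have cl: "word_elt d gs \<in> carrier A" "word_elt d hs \<in> carrier A"
    using assms by (simp_all add: word_elt_closed)
  have "(\<Oplus>\<^bsub>A\<^esub>j\<in>{0..d}. word_elt d (gs @ Gen s j # hs))
      = (\<Oplus>\<^bsub>A\<^esub>j\<in>{0..d}. word_elt d gs \<otimes>\<^bsub>A\<^esub> (gen d (Gen s j) \<otimes>\<^bsub>A\<^esub> word_elt d hs))"
    using assms cl by (intro R.finsum_cong') (auto simp: word_elt_append word_elt_Cons gen_closed)
  also have "\<dots> = word_elt d gs \<otimes>\<^bsub>A\<^esub> (\<Oplus>\<^bsub>A\<^esub>j\<in>{0..d}. gen d (Gen s j) \<otimes>\<^bsub>A\<^esub> word_elt d hs)"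
    using cl by (intro R.finsum_rdistr[symmetric]) (auto simp: gen_closed)
  also have "\<dots> = word_elt d gs \<otimes>\<^bsub>A\<^esub> ((\<Oplus>\<^bsub>A\<^esub>j\<in>{0..d}. gen d (Gen s j)) \<otimes>\<^bsub>A\<^esub> word_elt d hs)"
    using cl by (subst R.finsum_ldistr) (auto simp: gen_closed)
  also have "\<dots> = word_elt d (gs @ hs)"
    using assms cl by (simp add: gen_relations(2)[OF A] word_elt_append)
  finally show ?thesis .
qed

text \<open>Orthogonality of the two adjacent idempotents. This disposes of the product that remains
  once a letter between two entries has been summed out.\<close>

lemma word_elt_same_kind_zero:
  assumes "\<forall>g\<in>set (gs @ hs). index g \<le> d" "i \<le> d" "j \<le> d" "i \<noteq> j"
  shows "word_elt d (gs @ Gen s i # Gen s j # hs) = \<zero>\<^bsub>A\<^esub>"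
proof -
  have cl: "word_elt d gs \<in> carrier A" "word_elt d hs \<in> carrier A"
    "gen d (Gen s i) \<in> carrier A" "gen d (Gen s j) \<in> carrier A"
    using assms by (simp_all add: word_elt_closed gen_closed)
  have "word_elt d (gs @ Gen s i # Gen s j # hs)
      = word_elt d gs \<otimes>\<^bsub>A\<^esub> ((gen d (Gen s i) \<otimes>\<^bsub>A\<^esub> gen d (Gen s j)) \<otimes>\<^bsub>A\<^esub> word_elt d hs)"
    using assms cl by (simp add: word_elt_append word_elt_Cons R.m_assoc)
  then show ?thesis using assms cl by (simp add: gen_relations(1)[OF A])
qed

section \<open>Alternating words and insertion of an index\<close>

lemma index_alt_gens: "map index (alt_gens r) = r"
  by (induction r) simp_all

lemma index_alt_gens_le: "(\<forall>g\<in>set (alt_gens r). index g \<le> d) \<longleftrightarrow> set r \<subseteq> {..d}"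
  by (induction r) auto

text \<open>Kinds are counted from the right end, so an odd number of letters put on the right flips
  every kind in \<open>xs\<close>.\<close>

lemma alt_gens_append:
  "alt_gens (xs @ ys) = (if even (length ys) then alt_gens xs else map swap_gen (alt_gens xs)) @ alt_gens ys"
  by (induction xs) auto

lemma idx_word_closed: "set r \<subseteq> {..d} \<Longrightarrow> idx_word d r \<in> carrier A"
  unfolding idx_word_def by (intro word_elt_closed) (simp add: index_alt_gens_le)

lemma star_idx_word:
  "set r \<subseteq> {..d} \<Longrightarrow> star (idx_word d r :: 'k free set) = word_elt d (map swap_gen (alt_gens r))"
  unfolding idx_word_def by (intro star_word_elt) (simp add: index_alt_gens_le)

lemma star_star_idx_word:
  assumes "set r \<subseteq> {..d}"
  shows "star (star (idx_word d r :: 'k free set)) = idx_word d r"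
proof -
  have "\<forall>g\<in>set (map swap_gen (alt_gens r)). index g \<le> d"
    using assms by (simp add: index_alt_gens_le)
  then show ?thesis
    using assms by (simp add: star_idx_word star_word_elt idx_word_def del: map_map)
qed

text \<open>The kinds in \<open>xs\<close> are fixed by the \<open>length ys + 1\<close> letters to
  their right and persist when \<open>j\<close> is summed out. Hence the parity condition is
  opposite to that for \<open>alt_gens (xs @ ys)\<close>.\<close>

lemma finsum_idx_word_insert:
  assumes "set (xs @ ys) \<subseteq> {..d}"
  shows "(\<Oplus>\<^bsub>A\<^esub>j\<in>{0..d}. idx_word d (xs @ j # ys))
    = word_elt d ((if odd (length ys) then alt_gens xs else map swap_gen (alt_gens xs)) @ alt_gens ys)"
proof -
  have "\<forall>g\<in>set (alt_gens xs). index g \<le> d" "\<forall>g\<in>set (alt_gens ys). index g \<le> d"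
    using assms by (simp_all add: index_alt_gens_le)
  then show ?thesis
    unfolding idx_word_def alt_gens_append
    by (cases "odd (length ys)") (simp_all add: finsum_word_elt_insert ball_Un)
qed

lemma finsum_idx_word_Cons:
  assumes "r \<noteq> []" "set r \<subseteq> {..d}"
  shows "(\<Oplus>\<^bsub>A\<^esub>j\<in>{0..d} - {hd r}. idx_word d (j # r))
    = idx_word d r \<ominus>\<^bsub>A\<^esub> idx_word d (hd r # r)"
proof -
  have "hd r \<in> set r" using assms by simp
  then have "hd r \<le> d" using assms by blast
  then show ?thesis
    using finsum_idx_word_insert[of "[]" r] assms
    by (subst R.finsum_Diff_singleton) (auto simp: idx_word_closed idx_word_def[of d r])
qed

text \<open>The appended letter flips the kinds of all letters of \<open>r\<close>. Summing it out
  therefore leaves the starred word, in contrast to insertion at the left end.\<close>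

lemma finsum_idx_word_snoc:
  assumes "r \<noteq> []" "set r \<subseteq> {..d}"
  shows "(\<Oplus>\<^bsub>A\<^esub>j\<in>{0..d} - {last r}. idx_word d (r @ [j]))
    = star (idx_word d r) \<ominus>\<^bsub>A\<^esub> idx_word d (r @ [last r])"
proof -
  have "last r \<in> set r" using assms by simp
  then have "last r \<le> d" using assms by blast
  then show ?thesis
    using finsum_idx_word_insert[of r "[]"] assms
    by (subst R.finsum_Diff_singleton) (auto simp: idx_word_closed star_idx_word)
qed

lemma finsum_idx_word_between:
  assumes "set (xs @ a # b # ys) \<subseteq> {..d}" "a \<noteq> b"
  shows "(\<Oplus>\<^bsub>A\<^esub>j\<in>{0..d} - {a, b}. idx_word d (xs @ a # j # b # ys))
    = \<ominus>\<^bsub>A\<^esub> idx_word d (xs @ a # a # b # ys) \<ominus>\<^bsub>A\<^esub> idx_word d (xs @ a # b # b # ys)"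
proof -
  let ?f = "\<lambda>j. idx_word d (xs @ a # j # b # ys)"
  have cl: "?f j \<in> carrier A" if "j \<le> d" for j
    using assms that by (intro idx_word_closed) auto
  have ab: "a \<le> d" "b \<le> d" using assms by auto
  have "\<forall>g\<in>set (alt_gens xs). index g \<le> d" "\<forall>g\<in>set (alt_gens ys). index g \<le> d"
    using assms by (simp_all add: index_alt_gens_le)
  \<comment> \<open>Without the inserted letter, the neighbours of indices \<open>a\<close> and
    \<open>b\<close> have the same kind, and \<open>a \<noteq> b\<close> makes their product
    vanish.\<close>
  then have zero: "(\<Oplus>\<^bsub>A\<^esub>j\<in>{0..d}. ?f j) = \<zero>\<^bsub>A\<^esub>"
    using finsum_idx_word_insert[of "xs @ [a]" "b # ys"] assms ab
    by (cases "odd (length ys)")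
      (simp_all add: alt_gens_append word_elt_same_kind_zero ball_Un)
  \<comment> \<open>The two indices are removed one after the other; \<open>a \<noteq> b\<close>
    ensures that \<open>b\<close> is still present after the removal of \<open>a\<close>.\<close>
  have "(\<Oplus>\<^bsub>A\<^esub>j\<in>{0..d} - {a, b}. ?f j) = (\<Oplus>\<^bsub>A\<^esub>j\<in>{0..d} - {a} - {b}. ?f j)"
    by (rule arg_cong[where f = "finsum A ?f"]) auto
  also have "\<dots> = (\<zero>\<^bsub>A\<^esub> \<ominus>\<^bsub>A\<^esub> ?f a) \<ominus>\<^bsub>A\<^esub> ?f b"
    using ab assms(2) cl zero by (subst R.finsum_Diff_singleton; (subst R.finsum_Diff_singleton)?) auto
  finally show ?thesis using cl ab by (simp add: R.minus_eq)
qed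

section \<open>The first identity\<close>

lemma insertion_identity:
  assumes r: "r \<noteq> []" "set r \<subseteq> {..d}" "distinct_adj r" and n: "length r = n"
  shows "idx_word d r \<oplus>\<^bsub>A\<^esub> (-1) ^ n \<odot>\<^bsub>A\<^esub> star (idx_word d r) =
       (\<Oplus>\<^bsub>A\<^esub> j \<in> {0..d} - {hd r}. idx_word d (j # r))
       \<oplus>\<^bsub>A\<^esub> (\<Oplus>\<^bsub>A\<^esub> l \<in> {1..n - 1}. (-1) ^ l \<odot>\<^bsub>A\<^esub>
             (\<Oplus>\<^bsub>A\<^esub> j \<in> {0..d} - {r ! (l - 1), r ! l}. idx_word d (take l r @ j # drop l r)))
       \<oplus>\<^bsub>A\<^esub> (-1) ^ n \<odot>\<^bsub>A\<^esub> (\<Oplus>\<^bsub>A\<^esub> j \<in> {0..d} - {last r}. idx_word d (r @ [j]))"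
proof -
  \<comment> \<open>For \<open>l\<close> from 1 to \<open>n\<close>, \<open>take l r\<close> ends
    with the \<open>l\<close>-th entry and \<open>drop (l - 1) r\<close> begins with it, so this
    entry is doubled.\<close>
  define D :: "nat \<Rightarrow> 'k free set" where "D l = idx_word d (take l r @ drop (l - 1) r)" for l
  define u where "u = (\<ominus>\<^bsub>A\<^esub> \<one>\<^bsub>A\<^esub>) [^]\<^bsub>A\<^esub> n"
  let ?M = "\<lambda>l. \<Oplus>\<^bsub>A\<^esub> j \<in> {0..d} - {r ! (l - 1), r ! l}. idx_word d (take l r @ j # drop l r)"
  let ?w = "idx_word d r"
  \<comment> \<open>The telescoping lemma wants a ring element for every \<open>l\<close>. Outside
    the range from 1 to \<open>n\<close> the list is just \<open>r\<close>.\<close>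
  have D: "D l \<in> carrier A" for l
    unfolding D_def using r(2) set_take_subset[of l r] set_drop_subset[of "l - 1" r]
    by (intro idx_word_closed) auto
  have w: "?w \<in> carrier A" "star ?w \<in> carrier A" using r idx_word_closed by auto
  have u: "u \<in> carrier A" by (simp add: u_def)
  have n1: "n \<ge> 1" using r n by (cases r) auto
  have M: "?M l = \<ominus>\<^bsub>A\<^esub> D l \<ominus>\<^bsub>A\<^esub> D (Suc l)" if l: "l \<in> {1..n - 1}" for l
  proof -
    \<comment> \<open>\<open>r\<close> is cut around its entries number \<open>l\<close> and
      \<open>l + 1\<close>, at positions \<open>l - 1\<close> and \<open>l\<close>. Doubling
      \<open>a\<close> gives \<open>D l\<close>, and doubling \<open>b\<close> gives
      \<open>D (Suc l)\<close>.\<close>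
    define xs a b ys where "xs = take (l - 1) r" "a = r ! (l - 1)" "b = r ! l" "ys = drop (Suc l) r"
    note defs = this
    have r_eq: "drop l r = b # ys" "take l r = xs @ [a]" "drop (l - 1) r = a # b # ys"
      using l n Cons_nth_drop_Suc[of l r] Cons_nth_drop_Suc[of "l - 1" r]
        take_Suc_conv_app_nth[of "l - 1" r]
      by (auto simp: defs)
    have rr: "r = xs @ a # b # ys" using append_take_drop_id[of l r] r_eq by simp
    then have "a \<noteq> b" using r(3) by (simp add: distinct_adj_append_iff)
    moreover have "take (Suc l) r = xs @ [a, b]"
      using l n take_Suc_conv_app_nth[of l r] r_eq by (auto simp: defs)
    moreover have "set (xs @ a # b # ys) \<subseteq> {..d}" using r(2) rr by simp
    ultimately show ?thesis
      using finsum_idx_word_between[of xs a b ys]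
      by (simp add: D_def r_eq del: One_nat_def flip: defs(2,3))
  qed
  have "(\<Oplus>\<^bsub>A\<^esub> l \<in> {1..n - 1}. (-1) ^ l \<odot>\<^bsub>A\<^esub> ?M l)
      = (\<Oplus>\<^bsub>A\<^esub> l \<in> {1..n - 1}. (\<ominus>\<^bsub>A\<^esub> \<one>\<^bsub>A\<^esub>) [^]\<^bsub>A\<^esub> l \<otimes>\<^bsub>A\<^esub> (\<ominus>\<^bsub>A\<^esub> D l \<ominus>\<^bsub>A\<^esub> D (Suc l)))"
    using D by (intro R.finsum_cong') (auto simp: M smult_eq_scal_mult scal_power_minus_one simp del: One_nat_def)
  \<comment> \<open>Telescoping with \<open>m = n - 1\<close>; here \<open>n \<ge> 1\<close> turns
    \<open>Suc (n - 1)\<close> into \<open>n\<close>.\<close>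
  also have "\<dots> = D 1 \<oplus>\<^bsub>A\<^esub> u \<otimes>\<^bsub>A\<^esub> D n"
    using R.alternating_finsum_telescope[of D "n - 1"] D n1 by (simp add: u_def)
  finally have mid: "(\<Oplus>\<^bsub>A\<^esub> l \<in> {1..n - 1}. (-1) ^ l \<odot>\<^bsub>A\<^esub> ?M l) = D 1 \<oplus>\<^bsub>A\<^esub> u \<otimes>\<^bsub>A\<^esub> D n" .
  have D1: "D 1 = idx_word d (hd r # r)" using r by (cases r) (auto simp: D_def)
  have Dn: "D n = idx_word d (r @ [last r])"
    using r n by (cases r rule: rev_cases) (auto simp: D_def)
  \<comment> \<open>The terms \<open>D 1\<close> and \<open>D n\<close> left by the telescoping are
    exactly those subtracted in the two end sums.\<close>
  have "?w \<oplus>\<^bsub>A\<^esub> u \<otimes>\<^bsub>A\<^esub> star ?w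
      = (?w \<ominus>\<^bsub>A\<^esub> D 1) \<oplus>\<^bsub>A\<^esub> (D 1 \<oplus>\<^bsub>A\<^esub> u \<otimes>\<^bsub>A\<^esub> D n) \<oplus>\<^bsub>A\<^esub> u \<otimes>\<^bsub>A\<^esub> (star ?w \<ominus>\<^bsub>A\<^esub> D n)"
    using w u D[of 1] D[of n] by algebra
  then show ?thesis
    unfolding mid finsum_idx_word_Cons[OF r(1,2)] finsum_idx_word_snoc[OF r(1,2)]
    using w D[of n] by (simp add: smult_eq_scal_mult scal_power_minus_one u_def D1[symmetric] Dn[symmetric] del: One_nat_def)
qed

section \<open>The second identity, by applying \<open>star\<close>\<close>

lemma star_finsum:
  assumes "f \<in> B \<rightarrow> carrier A"
  shows "star (finsum A f B) = (\<Oplus>\<^bsub>A\<^esub>b\<in>B. star (f b))"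
  using assms
proof (induction B rule: infinite_finite_induct)
  case (insert b B)
  then show ?case by (auto simp: Pi_def)
\<comment> \<open>A sum over an infinite set is zero by convention, so this case, like the empty
  one, says that \<open>star\<close> fixes zero.\<close>
qed (use S.hom_zero in simp_all)

text \<open>Multiplication by \<open>(-1) ^ n\<close> exchanges the coefficients of the two end
  sums. It turns the sign \<open>(-1) ^ l\<close> into \<open>(-1) ^ (n - l)\<close>, because
  \<open>n + l\<close> and \<open>n - l\<close> have the same parity.\<close>

lemma star_insertion_identity:
  assumes r: "r \<noteq> []" "set r \<subseteq> {..d}" "distinct_adj r" and n: "length r = n"
  shows "idx_word d r \<oplus>\<^bsub>A\<^esub> (-1) ^ n \<odot>\<^bsub>A\<^esub> star (idx_word d r) =
       (\<Oplus>\<^bsub>A\<^esub> j \<in> {0..d} - {last r}. star (idx_word d (r @ [j])))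
       \<oplus>\<^bsub>A\<^esub> (\<Oplus>\<^bsub>A\<^esub> l \<in> {1..n - 1}. (-1) ^ (n - l) \<odot>\<^bsub>A\<^esub>
             (\<Oplus>\<^bsub>A\<^esub> j \<in> {0..d} - {r ! (l - 1), r ! l}. star (idx_word d (take l r @ j # drop l r))))
       \<oplus>\<^bsub>A\<^esub> (-1) ^ n \<odot>\<^bsub>A\<^esub> (\<Oplus>\<^bsub>A\<^esub> j \<in> {0..d} - {hd r}. star (idx_word d (j # r)))"
proof -
  define u where "u k = (\<ominus>\<^bsub>A\<^esub> \<one>\<^bsub>A\<^esub>) [^]\<^bsub>A\<^esub> (k::nat)" for k
  define B where "B l = {0..d} - {r ! (l - 1), r ! l}" for l
  define M where "M l = (\<Oplus>\<^bsub>A\<^esub> j \<in> B l. idx_word d (take l r @ j # drop l r))" for l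
  define E where "E = (\<Oplus>\<^bsub>A\<^esub> j \<in> {0..d} - {hd r}. idx_word d (j # r))"
  define E' where "E' = (\<Oplus>\<^bsub>A\<^esub> j \<in> {0..d} - {last r}. idx_word d (r @ [j]))"
  let ?w = "idx_word d r"
  have sm: "(-1) ^ k \<odot>\<^bsub>A\<^esub> X = u k \<otimes>\<^bsub>A\<^esub> X" if "X \<in> carrier A" for k X
    using that by (simp add: smult_eq_scal_mult scal_power_minus_one u_def)
  have u: "u k \<in> carrier A" for k by (simp add: u_def)
  have uu: "u j \<otimes>\<^bsub>A\<^esub> u k = u (j + k)" for j k by (simp add: u_def R.nat_pow_mult)
  \<comment> \<open>Even powers of \<open>-1\<close> are one already in the field;
    \<open>scal\<close> carries this over to the algebra.\<close>
  have u_even: "u k = \<one>\<^bsub>A\<^esub>" if "even k" for k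
    unfolding u_def scal_power_minus_one[symmetric]
    using that scal_power_minus_one[of 0] by simp
  have u_shift: "u n \<otimes>\<^bsub>A\<^esub> u l = u (n - l)" if "l \<le> n" for l
  proof -
    have "u n \<otimes>\<^bsub>A\<^esub> u l = u (n - l) \<otimes>\<^bsub>A\<^esub> u (2 * l)" using that by (simp add: uu add.commute)
    then show ?thesis by (simp add: u_even u)
  qed
  have star_u: "star (u k) = u k" for k
    unfolding u_def by (induction k) (use S.hom_one in simp_all)
  have cl_M: "idx_word d (take l r @ j # drop l r) \<in> carrier A" if "j \<le> d" for l j
    using that r(2) set_take_subset[of l r] set_drop_subset[of l r]
    by (intro idx_word_closed) auto
  have cl_E: "idx_word d (j # r) \<in> carrier A" "idx_word d (r @ [j]) \<in> carrier A"
    if "j \<le> d" for j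
    using that r(2) by (auto intro!: idx_word_closed)
  have M: "M l \<in> carrier A" for l
    unfolding M_def by (intro R.finsum_closed) (auto simp: B_def intro!: cl_M)
  have E: "E \<in> carrier A" "E' \<in> carrier A"
    unfolding E_def E'_def by (intro R.finsum_closed; auto intro!: cl_E)+
  have w: "?w \<in> carrier A" "star ?w \<in> carrier A" using r idx_word_closed by auto
  have starM: "star (M l) = (\<Oplus>\<^bsub>A\<^esub> j \<in> B l. star (idx_word d (take l r @ j # drop l r)))" for l
    unfolding M_def by (intro star_finsum) (auto simp: B_def intro!: cl_M)
  have starE: "star E = (\<Oplus>\<^bsub>A\<^esub> j \<in> {0..d} - {hd r}. star (idx_word d (j # r)))"
    "star E' = (\<Oplus>\<^bsub>A\<^esub> j \<in> {0..d} - {last r}. star (idx_word d (r @ [j])))"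
    unfolding E_def E'_def by (intro star_finsum; auto intro!: cl_E)+
  let ?T = "\<Oplus>\<^bsub>A\<^esub> l \<in> {1..n - 1}. u l \<otimes>\<^bsub>A\<^esub> M l"
  have T: "?T \<in> carrier A" using M u by auto
  have "(\<Oplus>\<^bsub>A\<^esub> l \<in> {1..n - 1}. (-1) ^ l \<odot>\<^bsub>A\<^esub> M l) = ?T"
    using M u by (intro R.finsum_cong') (auto simp: sm)
  then have "?w \<oplus>\<^bsub>A\<^esub> u n \<otimes>\<^bsub>A\<^esub> star ?w = E \<oplus>\<^bsub>A\<^esub> ?T \<oplus>\<^bsub>A\<^esub> u n \<otimes>\<^bsub>A\<^esub> E'"
    using insertion_identity[OF r n, folded B_def, folded M_def E_def E'_def] w E
    by (simp add: sm)
  then have "star (?w \<oplus>\<^bsub>A\<^esub> u n \<otimes>\<^bsub>A\<^esub> star ?w) = star (E \<oplus>\<^bsub>A\<^esub> ?T \<oplus>\<^bsub>A\<^esub> u n \<otimes>\<^bsub>A\<^esub> E')"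
    by (rule arg_cong)
  \<comment> \<open>On the left \<open>star\<close> exchanges the word and its image, since it is an
    involution there; the signs are fixed.\<close>
  then have *: "star ?w \<oplus>\<^bsub>A\<^esub> u n \<otimes>\<^bsub>A\<^esub> ?w = star E \<oplus>\<^bsub>A\<^esub> star ?T \<oplus>\<^bsub>A\<^esub> u n \<otimes>\<^bsub>A\<^esub> star E'"
    using w E T u star_star_idx_word[OF r(2)] by (simp add: star_u)
  have "u n \<otimes>\<^bsub>A\<^esub> star ?T = u n \<otimes>\<^bsub>A\<^esub> (\<Oplus>\<^bsub>A\<^esub> l \<in> {1..n - 1}. star (u l \<otimes>\<^bsub>A\<^esub> M l))"
    using M u by (subst star_finsum) auto
  also have "\<dots> = (\<Oplus>\<^bsub>A\<^esub> l \<in> {1..n - 1}. u n \<otimes>\<^bsub>A\<^esub> star (u l \<otimes>\<^bsub>A\<^esub> M l))"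
    using M u by (intro R.finsum_rdistr) auto
  also have "\<dots> = (\<Oplus>\<^bsub>A\<^esub> l \<in> {1..n - 1}. (-1) ^ (n - l) \<odot>\<^bsub>A\<^esub> star (M l))"
    using M u by (intro R.finsum_cong') (auto simp: sm star_u u_shift simp flip: R.m_assoc)
  finally have T': "u n \<otimes>\<^bsub>A\<^esub> star ?T = (\<Oplus>\<^bsub>A\<^esub> l \<in> {1..n - 1}. (-1) ^ (n - l) \<odot>\<^bsub>A\<^esub> star (M l))" .
  have sE: "star E \<in> carrier A" "star E' \<in> carrier A" "star ?T \<in> carrier A" using E T by auto
  have un: "u n \<otimes>\<^bsub>A\<^esub> (u n \<otimes>\<^bsub>A\<^esub> X) = X" if "X \<in> carrier A" for X
    using that u by (simp add: uu u_even flip: R.m_assoc)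
  \<comment> \<open>Since \<open>u n\<close> squares to one, multiplying by it moves the sign from
    \<open>?w\<close> to \<open>star ?w\<close> and restores the original left side.\<close>
  have "?w \<oplus>\<^bsub>A\<^esub> u n \<otimes>\<^bsub>A\<^esub> star ?w = u n \<otimes>\<^bsub>A\<^esub> (star ?w \<oplus>\<^bsub>A\<^esub> u n \<otimes>\<^bsub>A\<^esub> ?w)"
    using w u by (simp add: R.r_distr un R.a_comm)
  also have "\<dots> = star E' \<oplus>\<^bsub>A\<^esub> u n \<otimes>\<^bsub>A\<^esub> star ?T \<oplus>\<^bsub>A\<^esub> u n \<otimes>\<^bsub>A\<^esub> star E"
    unfolding * using sE u by (simp add: R.r_distr un R.a_ac)
  finally show ?thesis
    unfolding T' starM[unfolded B_def] starE using w sE by (simp add: sm starE)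
qed

end

theorem theorem3p3:
  fixes A :: "('k::field, 'k free set) module" and d n :: nat and r :: "nat list"
  assumes A: "A = idem_alg d" and d: "d \<ge> 1"
    and n: "n \<ge> 1" "length r = n"
    and word: "is_word d (alt_gens r)" and NR: "nonrepeating (alt_gens r)"
  shows
    "idx_word d r \<oplus>\<^bsub>A\<^esub> (-1) ^ n \<odot>\<^bsub>A\<^esub> star (idx_word d r) =
       (\<Oplus>\<^bsub>A\<^esub> j \<in> {0..d} - {hd r}. idx_word d (j # r))
       \<oplus>\<^bsub>A\<^esub> (\<Oplus>\<^bsub>A\<^esub> l \<in> {1..n - 1}. (-1) ^ l \<odot>\<^bsub>A\<^esub>
             (\<Oplus>\<^bsub>A\<^esub> j \<in> {0..d} - {r ! (l - 1), r ! l}. idx_word d (take l r @ j # drop l r)))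
       \<oplus>\<^bsub>A\<^esub> (-1) ^ n \<odot>\<^bsub>A\<^esub> (\<Oplus>\<^bsub>A\<^esub> j \<in> {0..d} - {last r}. idx_word d (r @ [j]))
     \<and>
     idx_word d r \<oplus>\<^bsub>A\<^esub> (-1) ^ n \<odot>\<^bsub>A\<^esub> star (idx_word d r) =
       (\<Oplus>\<^bsub>A\<^esub> j \<in> {0..d} - {last r}. star (idx_word d (r @ [j])))
       \<oplus>\<^bsub>A\<^esub> (\<Oplus>\<^bsub>A\<^esub> l \<in> {1..n - 1}. (-1) ^ (n - l) \<odot>\<^bsub>A\<^esub>
             (\<Oplus>\<^bsub>A\<^esub> j \<in> {0..d} - {r ! (l - 1), r ! l}. star (idx_word d (take l r @ j # drop l r))))
       \<oplus>\<^bsub>A\<^esub> (-1) ^ n \<odot>\<^bsub>A\<^esub> (\<Oplus>\<^bsub>A\<^esub> j \<in> {0..d} - {hd r}. star (idx_word d (j # r)))"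
proof -
  have "r \<noteq> []" using n by auto
  \<comment> \<open>The indices of \<open>alt_gens r\<close> form the list \<open>r\<close> itself,
    so both hypotheses on the word become conditions on \<open>r\<close>.\<close>
  moreover have "set r \<subseteq> {..d}"
    using word by (simp add: is_word_def index_alt_gens_le)
  moreover have "distinct_adj r"
    using NR by (simp add: nonrepeating_def index_alt_gens)
  ultimately show ?thesis
    using insertion_identity[OF A] star_insertion_identity[OF A] n(2) by blast
qed

end
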